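(* Let $n\ge2$ and let $\mathscr{L}:\Pi^n\to\mathbb{R}$ be a square positive, permutation symmetrical linear functional. Let $\mathscr{L}^1,\ldots,\mathscr{L}^n$ be the one-dimensional functionals and $c_2,\ldots,c_n$ the constants constructed in the context. Then there exists a cubature formula $$\mathscr{L}(f)\approx C(f):=\sum_{k=2}^{n}\sum_{i=1}^{m_k}w_{i,k}\,f(\underbrace{\alpha_{i,k},\ldots,\alpha_{i,k}}_{n-k+1},\beta_{i,k},\underbrace{\gamma,\ldots,\gamma}_{k-2})+\sum_{i=1}^{m_1}w_{i,1}\,f(\alpha_{i,1},\ldots,\alpha_{i,1})$$ which is exact for every polynomial of degree $\le 3$, i.e. $\mathscr{L}(f)=C(f)$ for all $f\in\Pi^n$ with $\deg f\le3$. Here, for each $k=1,\ldots,n$, $t_{i,k}$ and $w_{i,k}$ ($1\le i\le m_k$) are the real nodes and weights of a quadrature formula $\mathscr{L}^k(g)\approx\sum_{i=1}^{m_k}w_{i,k}\,g(t_{i,k})$ that is exact for all univariate polynomials $g$ of degree $\le3$, and the coordinates are given by \begin{align*} \gamma&=\frac{c_{n-1}-c_n}{n}\quad(\gamma=0\text{ if }n=2),\\ \beta_{i,k}&=\gamma-\frac{t_{i,k}}{n-k+2},\qquad \alpha_{i,k}=\beta_{i,k}+\frac{t_{i,k}-c_{n-k+1}}{n-k+1},\qquad 2\le k\le n-1,\\ \alpha_{i,1}&=\frac{t_{i,1}-c_n}{n},\\ \beta_{i,n}&=\gamma-\frac{t_{i,n}+c_2}{2},\qquad \alpha_{i,n}=\beta_{i,n}+t_{i,n}.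 \end{align*} That is, such quadrature formulas exist for all the $\mathscr{L}^k$, and any choice of them yields, through these formulas, a $C$ that is exact for every polynomial of degree $\le3$.
   Context: $\Pi^m$ is the space of real polynomials in $m$ variables and $\Pi^m_3$ its subspace of polynomials of degree at most $3$. A linear functional $\mathscr{L}:\Pi^n\to\mathbb{R}$ is square positive if $\mathscr{L}(p^2)>0$ for all nonzero $p$, and permutation symmetrical if its value is unchanged under any permutation of the variables $x_1,\ldots,x_n$. Decomposition process. Set $\mathscr{L}_0=\mathscr{L}$ (restricted to $\Pi^n_3$). For $k=0,1,\ldots,n-2$, given a linear functional $\mathscr{L}_k$ on $\Pi^{n-k}_3$ (variables $t_1,\ldots,t_{n-k}$), put $$c_{n-k}=-\frac{\mathscr{L}_k\big(t_1^3+(n-k-3)t_1^2t_2-(n-k-2)t_1t_2t_3\big)}{\mathscr{L}_k(t_1^2-t_1t_2)}$$ (the term with $t_3$ being absent when $n-k=2$), and define the polynomials in $t_1,\dots,t_{n-k}$ $$\lambda_i^{(k)}=t_i-t_{n-k}\ (1\le i\le n-k-1),\qquad \lambda_{n-k}^{(k)}=t_1+\cdots+t_{n-k}+c_{n-k}.$$ Choose real numbers $\xi_1^{(k)},\xi_2^{(k)}$ with $\xi_1^{(k)}+\xi_2^{(k)}=\mathscr{L}_k(1)$ (arbitrary otherwise). Let $\mathscr{L}_{k+1}$ be the linear functional on $\Pi^{n-k-1}_3$ (variables $\tau_1,\ldots,\tau_{n-k-1}$) with $$\mathscr{L}_{k+1}(1)=\xi_1^{(k)},\quad \mathscr{L}_{k+1}(\tau_i)=\mathscr{L}_k(\lambda_i^{(k)}),\quad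 \mathscr{L}_{k+1}(\tau_i\tau_j)=\mathscr{L}_k(\lambda_i^{(k)}\lambda_j^{(k)}),\quad \mathscr{L}_{k+1}(\tau_i\tau_j\tau_m)=\mathscr{L}_k(\lambda_i^{(k)}\lambda_j^{(k)}\lambda_m^{(k)})$$ for $1\le i,j,m\le n-k-1$, and let $\mathscr{L}^{k+1}$ be the linear functional on $\Pi^1_3$ (variable $\tau$) with $$\mathscr{L}^{k+1}(1)=\xi_2^{(k)},\qquad \mathscr{L}^{k+1}(\tau^j)=\mathscr{L}_k\big((\lambda_{n-k}^{(k)})^j\big),\quad j=1,2,3.$$ This defines $\mathscr{L}^1,\ldots,\mathscr{L}^{n-1}$ and $c_n,c_{n-1},\ldots,c_2$. Finally set $\mathscr{L}^n:=\mathscr{L}_{n-1}$, a linear functional on $\Pi^1_3$. *)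

theory Defs
  imports Complex_Main "HOL-Library.Poly_Mapping" "HOL-Combinatorics.Permutations"
begin

text \<open>Real polynomials in the variables \<open>x\<^sub>1, x\<^sub>2, \<dots>\<close> are finitely supported maps from exponent
  vectors to coefficients; the product is the convolution product of the type.\<close>

type_synonym mono = "nat \<Rightarrow>\<^sub>0 nat"
type_synonym mpoly = "mono \<Rightarrow>\<^sub>0 real"

definition Var :: "nat \<Rightarrow> mpoly" where
  "Var i = Poly_Mapping.single (Poly_Mapping.single i 1) 1"

definition Const :: "real \<Rightarrow> mpoly" where
  "Const a = Poly_Mapping.single 0 a"

definition mono_deg :: "mono \<Rightarrow> nat" where
  "mono_deg a = (\<Sum>i\<in>Poly_Mapping.keys a. Poly_Mapping.lookup a i)"

definition polys :: "nat \<Rightarrow> mpoly set" where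
  "polys m = {p. \<forall>a\<in>Poly_Mapping.keys p. Poly_Mapping.keys a \<subseteq> {1..m}}"

definition polys3 :: "nat \<Rightarrow> mpoly set" where
  "polys3 m = {p \<in> polys m. \<forall>a\<in>Poly_Mapping.keys p. mono_deg a \<le> 3}"

definition mono_at :: "mono \<Rightarrow> (nat \<Rightarrow> 'a) \<Rightarrow> 'a::comm_semiring_1" where
  "mono_at a x = (\<Prod>i\<in>Poly_Mapping.keys a. x i ^ Poly_Mapping.lookup a i)"

definition eval_poly :: "mpoly \<Rightarrow> (nat \<Rightarrow> real) \<Rightarrow> real" where
  "eval_poly p x = (\<Sum>a\<in>Poly_Mapping.keys p. Poly_Mapping.lookup p a * mono_at a x)"

definition subst_poly :: "mpoly \<Rightarrow> (nat \<Rightarrow> mpoly) \<Rightarrow> mpoly" where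
  "subst_poly p \<sigma> = (\<Sum>a\<in>Poly_Mapping.keys p. Const (Poly_Mapping.lookup p a) * mono_at a \<sigma>)"

definition linear_functional :: "nat \<Rightarrow> (mpoly \<Rightarrow> real) \<Rightarrow> bool" where
  "linear_functional n L \<longleftrightarrow>
     (\<forall>p\<in>polys n. \<forall>q\<in>polys n. L (p + q) = L p + L q) \<and>
     (\<forall>a. \<forall>p\<in>polys n. L (Const a * p) = a * L p)"

definition square_positive :: "nat \<Rightarrow> (mpoly \<Rightarrow> real) \<Rightarrow> bool" where
  "square_positive n L \<longleftrightarrow> (\<forall>p\<in>polys n. p \<noteq> 0 \<longrightarrow> L (p\<^sup>2) > 0)"

definition perm_symmetrical :: "nat \<Rightarrow> (mpoly \<Rightarrow> real) \<Rightarrow> bool" where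
  "perm_symmetrical n L \<longleftrightarrow>
     (\<forall>\<pi>. \<pi> permutes {1..n} \<longrightarrow> (\<forall>p\<in>polys n. L (subst_poly p (\<lambda>i. Var (\<pi> i))) = L p))"

text \<open>The linear functional with value \<open>\<xi>\<close> at 1 and value
  \<open>F (\<sigma>\<^sub>i\<^sub>1 \<cdots> \<sigma>\<^sub>i\<^sub>r)\<close> at every monomial \<open>\<tau>\<^sub>i\<^sub>1 \<cdots> \<tau>\<^sub>i\<^sub>r\<close> of positive degree.
  Only degrees at most 3 are ever used.\<close>

definition moment_functional ::
    "real \<Rightarrow> (mpoly \<Rightarrow> real) \<Rightarrow> (nat \<Rightarrow> mpoly) \<Rightarrow> mpoly \<Rightarrow> real" where
  "moment_functional \<xi> F \<sigma> p =
     (\<Sum>a\<in>Poly_Mapping.keys p. Poly_Mapping.lookup p a * (if a = 0 then \<xi> else F (mono_at a \<sigma>)))"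

text \<open>In the next two definitions \<open>m\<close> is the number of variables of \<open>F\<close>. For \<open>m = 2\<close> the
  coefficient of \<open>t\<^sub>1 t\<^sub>2 t\<^sub>3\<close> is zero, so that only \<open>t\<^sub>1\<close> and \<open>t\<^sub>2\<close> occur.\<close>

definition shift_const :: "nat \<Rightarrow> (mpoly \<Rightarrow> real) \<Rightarrow> real" where
  "shift_const m F =
     - F ((Var 1)^3 + Const (real m - 3) * (Var 1)\<^sup>2 * Var 2 - Const (real m - 2) * Var 1 * Var 2 * Var 3)
       / F ((Var 1)\<^sup>2 - Var 1 * Var 2)"

definition lam :: "nat \<Rightarrow> (mpoly \<Rightarrow> real) \<Rightarrow> nat \<Rightarrow> mpoly" where
  "lam m F i = (if i < m then Var i - Var m else (\<Sum>j=1..m. Var j) + Const (shift_const m F))"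

text \<open>\<open>lower_functional n L \<xi>1 k\<close> is the functional \<open>\<L>\<^sub>k\<close> in \<open>n - k\<close> variables.\<close>

primrec lower_functional ::
    "nat \<Rightarrow> (mpoly \<Rightarrow> real) \<Rightarrow> (nat \<Rightarrow> real) \<Rightarrow> nat \<Rightarrow> mpoly \<Rightarrow> real" where
  "lower_functional n L \<xi>1 0 = L"
| "lower_functional n L \<xi>1 (Suc k) =
     (let F = lower_functional n L \<xi>1 k in moment_functional (\<xi>1 k) F (lam (n - k) F))"

definition c_const :: "nat \<Rightarrow> (mpoly \<Rightarrow> real) \<Rightarrow> (nat \<Rightarrow> real) \<Rightarrow> nat \<Rightarrow> real" where
  "c_const n L \<xi>1 j = shift_const j (lower_functional n L \<xi>1 (n - j))"

text \<open>\<open>upper_functional n L \<xi>1 \<xi>2 k\<close>, for \<open>1 \<le> k \<le> n\<close>, is the functional \<open>\<L>\<^sup>k\<close> on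
  univariate polynomials, that is, polynomials in the single variable \<open>Var 1\<close>.\<close>

definition upper_functional ::
    "nat \<Rightarrow> (mpoly \<Rightarrow> real) \<Rightarrow> (nat \<Rightarrow> real) \<Rightarrow> (nat \<Rightarrow> real) \<Rightarrow> nat \<Rightarrow> mpoly \<Rightarrow> real" where
  "upper_functional n L \<xi>1 \<xi>2 k =
     (if k = n then lower_functional n L \<xi>1 (n - 1)
      else let F = lower_functional n L \<xi>1 (k - 1)
           in moment_functional (\<xi>2 (k - 1)) F (\<lambda>_. lam (n - (k - 1)) F (n - (k - 1))))"

definition quadrature3 :: "(mpoly \<Rightarrow> real) \<Rightarrow> nat \<Rightarrow> (nat \<Rightarrow> real) \<Rightarrow> (nat \<Rightarrow> real) \<Rightarrow> bool" where
  "quadrature3 F m t w \<longleftrightarrow> (\<forall>g\<in>polys3 1. F g = (\<Sum>i=1..m. w i * eval_poly g (\<lambda>_. t i)))"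

text \<open>In the following, \<open>c j\<close> stands for \<open>c\<^sub>j\<close>, and \<open>\<tau>\<close> for the quadrature node \<open>t\<^sub>i\<^sub>,\<^sub>k\<close>.\<close>

definition gamma :: "nat \<Rightarrow> (nat \<Rightarrow> real) \<Rightarrow> real" where
  "gamma n c = (if n = 2 then 0 else (c (n - 1) - c n) / real n)"

definition beta :: "nat \<Rightarrow> (nat \<Rightarrow> real) \<Rightarrow> nat \<Rightarrow> real \<Rightarrow> real" where
  "beta n c k \<tau> =
     (if k = n then gamma n c - (\<tau> + c 2) / 2
      else gamma n c - \<tau> / real (n - k + 2))"

definition alpha :: "nat \<Rightarrow> (nat \<Rightarrow> real) \<Rightarrow> nat \<Rightarrow> real \<Rightarrow> real" where
  "alpha n c k \<tau> =
     (if k = 1 then (\<tau> - c n) / real n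
      else if k = n then beta n c k \<tau> + \<tau>
      else beta n c k \<tau> + (\<tau> - c (n - k + 1)) / real (n - k + 1))"

definition node :: "nat \<Rightarrow> (nat \<Rightarrow> real) \<Rightarrow> nat \<Rightarrow> real \<Rightarrow> nat \<Rightarrow> real" where
  "node n c k \<tau> j =
     (if j \<le> n - k + 1 then alpha n c k \<tau>
      else if j = n - k + 2 then beta n c k \<tau>
      else gamma n c)"

definition cubature ::
    "nat \<Rightarrow> (nat \<Rightarrow> real) \<Rightarrow> (nat \<Rightarrow> nat) \<Rightarrow> (nat \<Rightarrow> nat \<Rightarrow> real) \<Rightarrow> (nat \<Rightarrow> nat \<Rightarrow> real) \<Rightarrow> mpoly \<Rightarrow> real" where
  "cubature n c m t w f =
     (\<Sum>k=2..n. \<Sum>i=1..m k. w k i * eval_poly f (node n c k (t k i))) +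
     (\<Sum>i=1..m 1. w 1 i * eval_poly f (\<lambda>_. alpha n c 1 (t 1 i)))"

text \<open>The functional given by \<open>moment_functional\<close> is linear and has the prescribed moments.\<close>

lemma moment_functional_superset:
  assumes "finite A" "Poly_Mapping.keys p \<subseteq> A"
  shows "moment_functional \<xi> F \<sigma> p =
    (\<Sum>a\<in>A. Poly_Mapping.lookup p a * (if a = 0 then \<xi> else F (mono_at a \<sigma>)))"
  unfolding moment_functional_def
  using assms by (intro sum.mono_neutral_left) (auto simp: in_keys_iff)

lemma moment_functional_add:
  "moment_functional \<xi> F \<sigma> (p + q) = moment_functional \<xi> F \<sigma> p + moment_functional \<xi> F \<sigma> q"
proof -
  let ?A = "Poly_Mapping.keys p \<union> Poly_Mapping.keys q"
  have "Poly_Mapping.keys (p + q) \<subseteq> ?A" by (rule Poly_Mapping.keys_add)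
  then show ?thesis
    by (simp only: moment_functional_superset[of ?A] lookup_add distrib_right sum.distrib
        finite_Un finite_keys Un_upper1 Un_upper2 simp_thms)
qed

lemma Const_mult_eq: "Const a * p = Poly_Mapping.map ((*) a) p"
  by (simp add: Const_def mult_map_scale_conv_mult)

lemma moment_functional_scale:
  "moment_functional \<xi> F \<sigma> (Const a * p) = a * moment_functional \<xi> F \<sigma> p"
proof -
  have *: "Poly_Mapping.lookup (Const a * p) b = a * Poly_Mapping.lookup p b" for b
    by (simp add: Const_mult_eq map.rep_eq when_def)
  then have "Poly_Mapping.keys (Const a * p) \<subseteq> Poly_Mapping.keys p"
    by (auto simp: in_keys_iff)
  then show ?thesis
    by (simp add: moment_functional_superset[of "Poly_Mapping.keys p"] * sum_distrib_left mult.assoc)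
qed

lemma mono_at_superset:
  assumes "finite A" "Poly_Mapping.keys a \<subseteq> A"
  shows "mono_at a x = (\<Prod>i\<in>A. x i ^ Poly_Mapping.lookup a i)"
  unfolding mono_at_def
  using assms by (intro prod.mono_neutral_left) (auto simp: in_keys_iff)

lemma mono_at_add: "mono_at (a + b) x = mono_at a x * mono_at b x"
proof -
  let ?A = "Poly_Mapping.keys a \<union> Poly_Mapping.keys b"
  have "Poly_Mapping.keys (a + b) \<subseteq> ?A" by (rule Poly_Mapping.keys_add)
  then show ?thesis
    by (simp add: mono_at_superset[of ?A] lookup_add power_add prod.distrib)
qed

lemma mono_at_single: "mono_at (Poly_Mapping.single i 1) x = x i"
  by (simp add: mono_at_def)

lemma moment_functional_monomial:
  "moment_functional \<xi> F \<sigma> (Poly_Mapping.single a 1) = (if a = 0 then \<xi> else F (mono_at a \<sigma>))"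
  by (simp add: moment_functional_def)

lemma moment_functional_moments:
  "moment_functional \<xi> F \<sigma> 1 = \<xi>"
  "moment_functional \<xi> F \<sigma> (Var i) = F (\<sigma> i)"
  "moment_functional \<xi> F \<sigma> (Var i * Var j) = F (\<sigma> i * \<sigma> j)"
  "moment_functional \<xi> F \<sigma> (Var i * Var j * Var l) = F (\<sigma> i * \<sigma> j * \<sigma> l)"
proof -
  have nz: "Poly_Mapping.single i (1::nat) + b \<noteq> 0" for i :: nat and b
    by (metis add_is_0 lookup_add lookup_single_eq lookup_zero one_neq_zero)
  have nz1: "Poly_Mapping.single i (1::nat) \<noteq> 0" for i :: nat
    using nz[of i 0] by simp
  show "moment_functional \<xi> F \<sigma> 1 = \<xi>"
    using moment_functional_monomial[of \<xi> F \<sigma> 0] by simp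
  show "moment_functional \<xi> F \<sigma> (Var i) = F (\<sigma> i)"
    using nz1[of i] by (simp only: Var_def moment_functional_monomial mono_at_single if_False)
  show "moment_functional \<xi> F \<sigma> (Var i * Var j) = F (\<sigma> i * \<sigma> j)"
    using nz by (simp only: Var_def mult_single mult_1 moment_functional_monomial mono_at_add
        mono_at_single if_False)
  show "moment_functional \<xi> F \<sigma> (Var i * Var j * Var l) = F (\<sigma> i * \<sigma> j * \<sigma> l)"
    using nz by (simp only: Var_def mult_single mult_1 moment_functional_monomial mono_at_add
        mono_at_single if_False add.assoc mult.assoc)
qed

end

theory Submission
  imports Defs
begin

text \<open>The polynomials \<open>1, \<lambda>\<^sub>1, \<dots>, \<lambda>\<^sub>m\<close> span the affine forms in \<open>m\<close> variables, so a cubature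
  formula of degree 3 only has to be checked on their triple products. If \<open>F\<close> is symmetric, every
  triple product containing both \<open>\<lambda>\<^sub>m\<close> and some \<open>\<lambda>\<^sub>i\<close> with \<open>i < m\<close> has \<open>F\<close>-value 0: if
  the cofactor of \<open>\<lambda>\<^sub>i\<close> is symmetric, exchange \<open>t\<^sub>i\<close> and \<open>t\<^sub>m\<close>; the remaining
  \<open>F (\<lambda>\<^sub>i \<lambda>\<^sub>j \<lambda>\<^sub>m)\<close> reduce by polarization to \<open>F ((t\<^sub>a - t\<^sub>b)\<^sup>2 \<lambda>\<^sub>m)\<close>, which the
  constant in \<open>\<lambda>\<^sub>m\<close> is chosen to annihilate. Hence a formula for the reduced functional, lifted
  to \<open>\<lambda>\<^sub>m = 0\<close>, and a quadrature formula on the diagonal line \<open>\<lambda>\<^sub>1 = \<dots> = \<lambda>\<^sub>m\<^sub>-\<^sub>1 = 0\<close> add up to a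
  formula for \<open>F\<close>. The reduced functional is again symmetric, with the same value at
  \<open>t\<^sub>1\<^sup>2 - t\<^sub>1 t\<^sub>2\<close>, which is positive since \<open>\<L>\<close> is square positive.\<close>

section \<open>Evaluation and substitution are ring homomorphisms\<close>

text \<open>The monomials of the last case are those of \<open>p\<close> itself, so bounds on its
  variables and degree stay available there.\<close>

lemma mpoly_induct [case_names zero add single]:
  assumes "P 0"
    and "\<And>p q. P p \<Longrightarrow> P q \<Longrightarrow> P (p + q)"
    and "\<And>a c. a \<in> Poly_Mapping.keys p \<Longrightarrow> P (Poly_Mapping.single a c)"
  shows "P (p :: mpoly)"
proof -
  have "p = (\<Sum>a\<in>Poly_Mapping.keys p. Poly_Mapping.single a (Poly_Mapping.lookup p a))"
    by (rule poly_mapping_eqI)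
      (auto simp: lookup_sum lookup_single when_def in_keys_iff)
  moreover have "P (\<Sum>a\<in>A. Poly_Mapping.single a (Poly_Mapping.lookup p a))"
    if "finite A" "A \<subseteq> Poly_Mapping.keys p" for A
    using that by (induction A rule: finite_induct) (auto intro: assms)
  ultimately show ?thesis by (metis finite_keys order_refl)
qed

lemma mono_at_zero [simp]: "mono_at 0 x = 1"
  by (simp add: mono_at_def)

text \<open>The coefficient map \<open>h\<close> is the identity for evaluation at real points and
  \<open>Const\<close> for substitution of polynomials, so one development serves both.\<close>

locale poly_evaluation =
  fixes h :: "real \<Rightarrow> 'b::comm_ring_1" and ev :: "mpoly \<Rightarrow> (nat \<Rightarrow> 'b) \<Rightarrow> 'b"
  assumes h_add: "h (a + b) = h a + h b" and h_mult: "h (a * b) = h a * h b" and h_one: "h 1 = 1"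
    and ev_eq: "ev p x = (\<Sum>a\<in>Poly_Mapping.keys p. h (Poly_Mapping.lookup p a) * mono_at a x)"
begin

lemma h_zero: "h 0 = 0"
  using h_add[of 0 0] by simp

lemma ev_superset:
  assumes "finite A" "Poly_Mapping.keys p \<subseteq> A"
  shows "ev p x = (\<Sum>a\<in>A. h (Poly_Mapping.lookup p a) * mono_at a x)"
  unfolding ev_eq using assms by (intro sum.mono_neutral_left) (auto simp: in_keys_iff h_zero)

lemma ev_zero [simp]: "ev 0 x = 0"
  by (simp add: ev_eq)

lemma ev_add [simp]: "ev (p + q) x = ev p x + ev q x"
proof -
  let ?A = "Poly_Mapping.keys p \<union> Poly_Mapping.keys q"
  have "Poly_Mapping.keys (p + q) \<subseteq> ?A" by (rule Poly_Mapping.keys_add)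
  then show ?thesis
    by (simp add: ev_superset[of ?A] lookup_add distrib_right sum.distrib h_add)
qed

lemma ev_single: "ev (Poly_Mapping.single a c) x = h c * mono_at a x"
  by (simp add: ev_eq h_zero)

lemma ev_mult [simp]: "ev (p * q) x = ev p x * ev q x"
proof (induction p rule: mpoly_induct)
  case (single a c)
  show ?case
  proof (induction q rule: mpoly_induct)
    case (single b d)
    show ?case
      by (simp add: mult_single ev_single mono_at_add h_mult mult_ac)
  qed (simp_all add: distrib_left)
qed (simp_all add: distrib_right)

lemma ev_one [simp]: "ev 1 x = 1"
  using ev_single[of 0 1 x] by (simp add: h_one)

lemma ev_Const [simp]: "ev (Const a) x = h a"
  by (simp add: Const_def ev_single)

lemma ev_Var [simp]: "ev (Var i) x = x i"
  using ev_single[of "Poly_Mapping.single i 1" 1 x] by (simp add: Var_def h_one mono_at_def)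

lemma ev_uminus [simp]: "ev (- p) x = - ev p x"
  by (metis add_eq_0_iff ev_add ev_zero)

lemma ev_diff [simp]: "ev (p - q) x = ev p x - ev q x"
  by (metis ev_add ev_uminus add_uminus_conv_diff)

lemma ev_power [simp]: "ev (p ^ k) x = ev p x ^ k"
  by (induction k) simp_all

lemma ev_sum [simp]: "ev (\<Sum>i\<in>A. f i) x = (\<Sum>i\<in>A. ev (f i) x)"
  by (induction A rule: infinite_finite_induct) simp_all

lemma ev_prod [simp]: "ev (\<Prod>i\<in>A. f i) x = (\<Prod>i\<in>A. ev (f i) x)"
  by (induction A rule: infinite_finite_induct) simp_all

lemma ev_mono_at [simp]: "ev (mono_at a \<sigma>) x = mono_at a (\<lambda>i. ev (\<sigma> i) x)"
  by (simp add: mono_at_def)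

lemma ev_cong:
  assumes "p \<in> polys m" "\<And>i. i \<in> {1..m} \<Longrightarrow> x i = y i"
  shows "ev p x = ev p y"
proof -
  have "mono_at a x = mono_at a y" if "a \<in> Poly_Mapping.keys p" for a
  proof -
    have "Poly_Mapping.keys a \<subseteq> {1..m}"
      using assms(1) that by (auto simp: polys_def)
    then show ?thesis
      unfolding mono_at_def by (intro prod.cong refl) (metis assms(2) subsetD)
  qed
  then show ?thesis
    by (simp add: ev_eq)
qed

end

lemma Const_add: "Const (a + b) = Const a + Const b"
  by (simp add: Const_def single_add)

lemma Const_mult: "Const (a * b) = Const a * Const b"
  by (simp add: Const_def mult_single)

lemma Const_1 [simp]: "Const 1 = 1"
  by (simp add: Const_def)

lemma Const_0 [simp]: "Const 0 = 0"
  by (simp add: Const_def)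

interpretation eval_poly: poly_evaluation "\<lambda>c. c" eval_poly
  by unfold_locales (simp_all add: eval_poly_def)

interpretation subst_poly: poly_evaluation Const subst_poly
  by unfold_locales (simp_all add: subst_poly_def Const_add Const_mult)

lemma subst_poly_subst_poly:
  "subst_poly (subst_poly p \<sigma>) \<rho> = subst_poly p (\<lambda>i. subst_poly (\<sigma> i) \<rho>)"
  unfolding subst_poly_def[of p] by simp

lemma eval_poly_subst_poly:
  "eval_poly (subst_poly p \<sigma>) x = eval_poly p (\<lambda>i. eval_poly (\<sigma> i) x)"
  unfolding subst_poly_def eval_poly_def[of p] by simp

text \<open>With the constant term written as a value at the origin,
  \<open>eval_poly_subst_poly\<close> shows that renaming variables preserves it.\<close>

lemma eval_poly_at_zero: "eval_poly p (\<lambda>_. 0) = Poly_Mapping.lookup p 0"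
proof -
  have *: "mono_at a (\<lambda>_. 0 :: real) = of_bool (a = 0)" for a
    by (auto simp: mono_at_def in_keys_iff prod_zero_iff poly_mapping_eq_iff fun_eq_iff)
  show ?thesis
    by (simp add: eval_poly_def * in_keys_iff sum.If_cases if_distrib of_bool_def cong: if_cong)
qed

section \<open>Polynomials in a bounded number of variables\<close>

lemma polys_0 [simp]: "0 \<in> polys m"
  and polys_1 [simp]: "1 \<in> polys m"
  and polys_Const [simp]: "Const c \<in> polys m"
  by (simp_all add: polys_def Const_def)

lemma polys_Var [simp]: "i \<in> {1..m} \<Longrightarrow> Var i \<in> polys m"
  by (simp add: polys_def Var_def)

lemma polys_add [simp]:
  assumes "p \<in> polys m" "q \<in> polys m"
  shows "p + q \<in> polys m"
  using assms Poly_Mapping.keys_add[of p q] unfolding polys_def by blast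

lemma polys_mult [simp]:
  assumes "p \<in> polys m" "q \<in> polys m"
  shows "p * q \<in> polys m"
proof -
  have "Poly_Mapping.keys c \<subseteq> {1..m}" if c: "c \<in> Poly_Mapping.keys (p * q)" for c
  proof -
    obtain a b where "c = a + b" "a \<in> Poly_Mapping.keys p" "b \<in> Poly_Mapping.keys q"
      using c keys_mult[of p q] by blast
    then show ?thesis
      using assms Poly_Mapping.keys_add[of a b] unfolding polys_def by blast
  qed
  then show ?thesis by (simp add: polys_def)
qed

lemma polys_numeral [simp]: "numeral k \<in> polys m"
  using polys_Const[of "numeral k" m] by (simp add: Const_def)

lemma polys_uminus [simp]: "p \<in> polys m \<Longrightarrow> - p \<in> polys m"
  by (simp add: polys_def in_keys_iff)

lemma polys_diff [simp]: "p \<in> polys m \<Longrightarrow> q \<in> polys m \<Longrightarrow> p - q \<in> polys m"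
  by (metis polys_add polys_uminus add_uminus_conv_diff)

lemma polys_power [simp]: "p \<in> polys m \<Longrightarrow> p ^ k \<in> polys m"
  by (induction k) simp_all

lemma polys_sum [simp]: "(\<And>i. i \<in> A \<Longrightarrow> f i \<in> polys m) \<Longrightarrow> (\<Sum>i\<in>A. f i) \<in> polys m"
  by (induction A rule: infinite_finite_induct) simp_all

lemma polys_prod [simp]: "(\<And>i. i \<in> A \<Longrightarrow> f i \<in> polys m) \<Longrightarrow> (\<Prod>i\<in>A. f i) \<in> polys m"
  by (induction A rule: infinite_finite_induct) simp_all

lemma mono_at_in_polys:
  "Poly_Mapping.keys a \<subseteq> {1..k} \<Longrightarrow> (\<And>i. i \<in> {1..k} \<Longrightarrow> \<sigma> i \<in> polys m) \<Longrightarrow> mono_at a \<sigma> \<in> polys m"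
  unfolding mono_at_def by (intro polys_prod polys_power) blast

lemma subst_poly_in_polys:
  assumes "p \<in> polys k" "\<And>i. i \<in> {1..k} \<Longrightarrow> \<sigma> i \<in> polys m"
  shows "subst_poly p \<sigma> \<in> polys m"
  using assms(1) unfolding subst_poly_def polys_def[of k]
  by (intro polys_sum polys_mult polys_Const mono_at_in_polys[of _ k] assms(2)) auto

text \<open>Index 0 stands for the constant 1, so that triple products of homogenized variables
  enumerate all monomials of degree at most 3.\<close>

definition hvar :: "nat \<Rightarrow> mpoly" where
  "hvar i = (if i = 0 then 1 else Var i)"

lemma hvar_simps [simp]: "hvar 0 = 1" "i > 0 \<Longrightarrow> hvar i = Var i"
  by (simp_all add: hvar_def)

lemma polys_hvar [simp]: "i \<le> m \<Longrightarrow> hvar i \<in> polys m"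
  by (simp add: hvar_def)

section \<open>Cubic polynomials as combinations of triple products\<close>

lemma mono_deg_superset:
  assumes "finite A" "Poly_Mapping.keys a \<subseteq> A"
  shows "mono_deg a = (\<Sum>i\<in>A. Poly_Mapping.lookup a i)"
  unfolding mono_deg_def using assms by (intro sum.mono_neutral_left) (auto simp: in_keys_iff)

lemma mono_deg_add: "mono_deg (a + b) = mono_deg a + mono_deg b"
proof -
  let ?A = "Poly_Mapping.keys a \<union> Poly_Mapping.keys b"
  have "Poly_Mapping.keys (a + b) \<subseteq> ?A" by (rule Poly_Mapping.keys_add)
  then show ?thesis
    by (simp add: mono_deg_superset[of ?A] lookup_add sum.distrib)
qed

text \<open>Variables are split off one at a time; once the monomial is 1, index 0 pads the list to
  exactly \<open>d\<close> factors.\<close>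

lemma monomial_as_hvar_product:
  assumes "Poly_Mapping.keys a \<subseteq> {1..m}" "mono_deg a \<le> d"
  shows "\<exists>is. length is = d \<and> set is \<subseteq> {0..m} \<and> Poly_Mapping.single a 1 = prod_list (map hvar is)"
  using assms
proof (induction d arbitrary: a)
  case 0
  then have "a = 0"
    by (auto simp: mono_deg_def in_keys_iff poly_mapping_eq_iff fun_eq_iff)
  then show ?case by simp
next
  case (Suc d)
  show ?case
  proof (cases "a = 0")
    case True
    then show ?thesis
      by (intro exI[of _ "replicate (Suc d) 0"]) auto
  next
    case False
    then obtain i where i: "i \<in> Poly_Mapping.keys a"
      by (metis in_keys_iff lookup_zero poly_mapping_eqI)
    define b where "b = a - Poly_Mapping.single i 1"
    have a: "a = Poly_Mapping.single i 1 + b"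
      using i by (intro poly_mapping_eqI)
        (auto simp: b_def lookup_add lookup_minus lookup_single when_def in_keys_iff)
    have "Poly_Mapping.keys b \<subseteq> Poly_Mapping.keys a"
      by (auto simp: a in_keys_iff lookup_add)
    moreover have "mono_deg a = Suc (mono_deg b)"
      unfolding a mono_deg_add by (simp add: mono_deg_def)
    ultimately obtain "is" where "is": "length is = d" "set is \<subseteq> {0..m}"
        "Poly_Mapping.single b (1::real) = prod_list (map hvar is)"
      using Suc.IH[of b] Suc.prems by auto
    have "i \<in> {1..m}" using i Suc.prems by auto
    moreover have "Poly_Mapping.single a (1::real) = Var i * Poly_Mapping.single b 1"
      by (simp add: a Var_def mult_single)
    ultimately show ?thesis
      using "is" by (intro exI[of _ "i # is"]) auto
  qed
qed

lemma polys3_induct [consumes 1, case_names add scale prod]: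
  assumes f: "f \<in> polys3 m"
    and add: "\<And>p q. P p \<Longrightarrow> P q \<Longrightarrow> P (p + q)"
    and scale: "\<And>a p. P p \<Longrightarrow> P (Const a * p)"
    and prod: "\<And>i j l. i \<le> m \<Longrightarrow> j \<le> m \<Longrightarrow> l \<le> m \<Longrightarrow> P (hvar i * hvar j * hvar l)"
  shows "P f"
proof (induction f rule: mpoly_induct)
  case zero
  show ?case using scale[OF prod[of 0 0 0], of 0] by simp
next
  case (single a c)
  then have "Poly_Mapping.keys a \<subseteq> {1..m}" "mono_deg a \<le> 3"
    using f by (auto simp: polys3_def polys_def)
  then obtain "is" where "is": "length is = 3" "set is \<subseteq> {0..m}"
      "Poly_Mapping.single a (1::real) = prod_list (map hvar is)"
    using monomial_as_hvar_product by blast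
  then obtain i j l where "is = [i, j, l]"
    by (auto simp: numeral_3_eq_3 length_Suc_conv)
  then have "P (Poly_Mapping.single a 1)"
    using prod[of i j l] "is" by (simp add: mult.assoc)
  moreover have "Poly_Mapping.single a c = Const c * Poly_Mapping.single a 1"
    by (simp add: Const_def mult_single)
  ultimately show ?case by (simp only: scale)
qed (rule add)

text \<open>The permutation composes three transpositions, \<open>r\<close> acting first. Each
  target is pulled back through those already chosen, and distinctness keeps \<open>q\<close> and
  \<open>r\<close> from moving the points settled before.\<close>

lemma ex_permutation_of_three:
  fixes a b c :: nat
  assumes "3 \<le> m" "{a, b, c} \<subseteq> {1..m}" "a \<noteq> b" "a \<noteq> c" "b \<noteq> c"
  shows "\<exists>\<pi>. \<pi> permutes {1..m} \<and> \<pi> 1 = a \<and> \<pi> 2 = b \<and> \<pi> 3 = c"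
proof -
  define p where "p = Transposition.transpose 1 a"
  define b' where "b' = p b"
  define q where "q = Transposition.transpose 2 b'"
  define c' where "c' = q (p c)"
  define r where "r = Transposition.transpose 3 c'"
  have perm: "p permutes {1..m}" "b' \<in> {1..m}"
    using assms by (auto simp: p_def b'_def Transposition.transpose_def intro!: permutes_swap_id)
  have q: "q permutes {1..m}" "c' \<in> {1..m}" "p c \<in> {1..m}"
    using assms perm by (auto simp: p_def q_def c'_def Transposition.transpose_def intro!: permutes_swap_id)
  have r: "r permutes {1..m}"
    using assms q by (auto simp: r_def intro!: permutes_swap_id)
  have ne: "b' \<noteq> 1" "p c \<noteq> 1" "b' \<noteq> p c"
    using assms by (auto simp: p_def b'_def Transposition.transpose_def)
  have ne': "c' \<noteq> 1" "c' \<noteq> 2"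
    using ne by (auto simp: c'_def q_def Transposition.transpose_def)
  have "(p \<circ> q \<circ> r) permutes {1..m}"
    using perm q r by (intro permutes_compose)
  moreover have "(p \<circ> q \<circ> r) 1 = a"
    using ne ne' by (simp add: r_def q_def p_def Transposition.transpose_def)
  moreover have "r 2 = 2" "q 2 = b'" "p b' = b"
    using ne' by (simp_all add: r_def q_def p_def b'_def Transposition.transpose_def)
  moreover have "r 3 = c'" "q c' = p c" "p (p c) = c"
    by (simp_all add: r_def q_def c'_def p_def)
  ultimately show ?thesis
    by (intro exI[of _ "p \<circ> q \<circ> r"]) simp
qed

lemma hvar_product_in_polys3:
  assumes "i \<le> m" "j \<le> m" "l \<le> m"
  shows "hvar i * hvar j * hvar l \<in> polys3 m"
proof -
  define e :: "nat \<Rightarrow> mono" where "e i = (if i = 0 then 0 else Poly_Mapping.single i 1)" for i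
  have hvar: "hvar i = Poly_Mapping.single (e i) 1" and "mono_deg (e i) \<le> 1" for i
    by (simp_all add: e_def hvar_def Var_def mono_deg_def)
  then have "mono_deg (e i + e j + e l) \<le> 1 + 1 + 1"
    unfolding mono_deg_add by (intro add_mono)
  then show ?thesis
    using assms by (simp add: polys3_def) (simp add: hvar mult_single)
qed

lemma moment_functional_hvar:
  "moment_functional \<xi> F \<sigma> (hvar i * hvar j * hvar l) =
     (if i = 0 \<and> j = 0 \<and> l = 0 then \<xi>
      else F ((if i = 0 then 1 else \<sigma> i) * (if j = 0 then 1 else \<sigma> j) * (if l = 0 then 1 else \<sigma> l)))"
  by (cases "i = 0"; cases "j = 0"; cases "l = 0") (simp_all add: moment_functional_moments)

section \<open>Symmetric functionals\<close>

locale linear_functional_on =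
  fixes m :: nat and F :: "mpoly \<Rightarrow> real"
  assumes linear: "linear_functional m F"
begin

lemma F_add [simp]: "p \<in> polys m \<Longrightarrow> q \<in> polys m \<Longrightarrow> F (p + q) = F p + F q"
  and F_scale [simp]: "p \<in> polys m \<Longrightarrow> F (Const a * p) = a * F p"
  using linear by (simp_all add: linear_functional_def)

lemma F_zero [simp]: "F 0 = 0"
  using F_scale[of 0 0] by simp

lemma F_uminus [simp]: "p \<in> polys m \<Longrightarrow> F (- p) = - F p"
  using F_add[of p "- p"] by simp

lemma F_diff [simp]: "p \<in> polys m \<Longrightarrow> q \<in> polys m \<Longrightarrow> F (p - q) = F p - F q"
  using F_add[of p "- q"] by simp

lemma F_numeral [simp]: "p \<in> polys m \<Longrightarrow> F (numeral k * p) = numeral k * F p"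
  using F_scale[of p "numeral k"] by (simp add: Const_def)

lemma F_sum: "(\<And>i. i \<in> A \<Longrightarrow> f i \<in> polys m) \<Longrightarrow> F (\<Sum>i\<in>A. f i) = (\<Sum>i\<in>A. F (f i))"
  by (induction A rule: infinite_finite_induct) simp_all

text \<open>On nonconstant monomials both sides apply \<open>F\<close> to the substituted monomial;
  only the constant term, worth \<open>\<xi>\<close> instead of \<open>F 1\<close>, needs a
  correction.\<close>

lemma moment_functional_eq_subst:
  assumes "p \<in> polys k" "\<And>i. i \<in> {1..k} \<Longrightarrow> \<sigma> i \<in> polys m"
  shows "moment_functional \<xi> F \<sigma> p = F (subst_poly p \<sigma>) + Poly_Mapping.lookup p 0 * (\<xi> - F 1)"
proof -
  have mono: "mono_at a \<sigma> \<in> polys m" if "a \<in> Poly_Mapping.keys p" for a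
    using assms that by (intro mono_at_in_polys[of _ k]) (auto simp: polys_def)
  then have "F (subst_poly p \<sigma>) = (\<Sum>a\<in>Poly_Mapping.keys p. Poly_Mapping.lookup p a * F (mono_at a \<sigma>))"
    unfolding subst_poly_def by (subst F_sum) simp_all
  moreover have "Poly_Mapping.lookup p 0 * (\<xi> - F 1) =
      (\<Sum>a\<in>Poly_Mapping.keys p. if a = 0 then Poly_Mapping.lookup p a * (\<xi> - F 1) else 0)"
    by (simp add: in_keys_iff)
  ultimately show ?thesis
    unfolding moment_functional_def
    by (simp only: flip: sum.distrib) (auto intro!: sum.cong simp: algebra_simps)
qed

end

lemma linear_functional_moment_functional: "linear_functional k (moment_functional \<xi> F \<sigma>)"
  by (simp add: linear_functional_def moment_functional_add moment_functional_scale)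

locale symmetric_functional = linear_functional_on +
  assumes symmetrical: "perm_symmetrical m F"
begin

section \<open>Moments of a symmetric functional up to degree 3\<close>

definition "m11 = F (Var 1 * Var 1)"
definition "m12 = F (Var 1 * Var 2)"
definition "m111 = F (Var 1 * (Var 1 * Var 1))"
definition "m112 = F (Var 1 * (Var 1 * Var 2))"
text \<open>For \<open>m = 2\<close> the argument lies outside \<open>polys m\<close> and nothing is
  known about this value; it then occurs only with coefficient 0.\<close>

definition "m123 = F (Var 1 * (Var 2 * Var 3))"

lemma F_perm:
  assumes "\<pi> permutes {1..m}" "p \<in> polys m"
  shows "F (subst_poly p (\<lambda>i. Var (\<pi> i))) = F p"
  using symmetrical assms by (simp add: perm_symmetrical_def)

text \<open>For \<open>m >= 3\<close> a third index completes the pair to a triple; for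
  \<open>m = 2\<close> there is none, and the two permutations are given explicitly.\<close>

lemma ex_permutation_of_two:
  fixes a b :: nat
  assumes "{a, b} \<subseteq> {1..m}" "a \<noteq> b"
  shows "\<exists>\<pi>. \<pi> permutes {1..m} \<and> \<pi> 1 = a \<and> \<pi> 2 = b"
proof (cases "m = 2")
  case True
  then have "(a = 1 \<and> b = 2) \<or> (a = 2 \<and> b = 1)"
    using assms by auto
  then show ?thesis
  proof
    assume "a = 1 \<and> b = 2"
    then show ?thesis by (intro exI[of _ id]) (auto simp: permutes_id)
  next
    assume "a = 2 \<and> b = 1"
    then show ?thesis using True
      by (intro exI[of _ "Transposition.transpose 1 2"]) (auto intro!: permutes_swap_id)
  qed
next
  case False
  then have m: "3 \<le> m" using assms by auto
  have "card {a, b} < card {1..m}"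
    using m assms by simp
  then obtain c where "c \<in> {1..m}" "c \<notin> {a, b}"
    by (metis card_mono finite.emptyI finite.insertI not_le subsetI)
  then show ?thesis
    using ex_permutation_of_three[of m a b c] m assms by auto
qed

lemma moment_1_1:
  assumes "a \<in> {1..m}"
  shows "F (Var a * Var a) = m11" "F (Var a * (Var a * Var a)) = m111"
proof -
  have \<pi>: "Transposition.transpose 1 a permutes {1..m}"
    using assms by (intro permutes_swap_id) auto
  show "F (Var a * Var a) = m11"
    using F_perm[OF \<pi>, of "Var 1 * Var 1"] assms by (simp add: m11_def)
  show "F (Var a * (Var a * Var a)) = m111"
    using F_perm[OF \<pi>, of "Var 1 * (Var 1 * Var 1)"] assms by (simp add: m111_def)
qed

text \<open>The expansions below use \<open>ring_distribs\<close> and \<open>mult.assoc\<close> but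
  no commutativity, hence the three orders of the factors for \<open>m112\<close>.\<close>

lemma moment_1_2:
  assumes "a \<in> {1..m}" "b \<in> {1..m}" "a \<noteq> b"
  shows "F (Var a * Var b) = m12"
    and "F (Var a * (Var a * Var b)) = m112"
    and "F (Var a * (Var b * Var a)) = m112"
    and "F (Var b * (Var a * Var a)) = m112"
proof -
  obtain \<pi> where \<pi>: "\<pi> permutes {1..m}" "\<pi> 1 = a" "\<pi> 2 = b"
    using ex_permutation_of_two assms by blast
  have "2 \<le> m" using assms by auto
  then show "F (Var a * Var b) = m12"
    using F_perm[OF \<pi>(1), of "Var 1 * Var 2"] \<pi>(2,3) by (simp add: m12_def)
  show *: "F (Var a * (Var a * Var b)) = m112"
    using F_perm[OF \<pi>(1), of "Var 1 * (Var 1 * Var 2)"] \<pi>(2,3) \<open>2 \<le> m\<close> by (simp add: m112_def)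
  show "F (Var a * (Var b * Var a)) = m112" "F (Var b * (Var a * Var a)) = m112"
    using * by (simp_all add: mult_ac)
qed

lemma moment_1_2_3:
  assumes "a \<in> {1..m}" "b \<in> {1..m}" "c \<in> {1..m}" "a \<noteq> b" "a \<noteq> c" "b \<noteq> c"
  shows "F (Var a * (Var b * Var c)) = m123"
proof -
  have "card {a, b, c} \<le> card {1..m}"
    using assms by (intro card_mono) auto
  then have m: "3 \<le> m"
    using assms by simp
  then obtain \<pi> where \<pi>: "\<pi> permutes {1..m}" "\<pi> 1 = a" "\<pi> 2 = b" "\<pi> 3 = c"
    using ex_permutation_of_three[of m a b c] assms by auto
  then show ?thesis
    using F_perm[OF \<pi>(1), of "Var 1 * (Var 2 * Var 3)"] m by (simp add: m123_def)
qed

lemmas moments = moment_1_1 moment_1_2 moment_1_2_3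

lemma second_difference:
  "2 \<le> m \<Longrightarrow> F ((Var 1)\<^sup>2 - Var 1 * Var 2) = m11 - m12"
  by (simp add: power2_eq_square moments)

lemma shift_const_eq:
  assumes "2 \<le> m"
  shows "shift_const m F = - (m111 + (real m - 3) * m112 - (real m - 2) * m123) / (m11 - m12)"
proof -
  have "F ((Var 1)^3 + Const (real m - 3) * (Var 1)\<^sup>2 * Var 2 - Const (real m - 2) * Var 1 * Var 2 * Var 3)
      = m111 + (real m - 3) * m112 - (real m - 2) * m123"
  proof (cases "m = 2")
    \<comment> \<open>The coefficient of the term with \<open>Var 3\<close> is 0 here, so linearity
      of \<open>F\<close> is not called for outside \<open>polys m\<close>.\<close>
    case True
    then show ?thesis
      by (simp add: power2_eq_square power3_eq_cube mult.assoc moments)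
  next
    case False
    then show ?thesis using assms
      by (simp add: power2_eq_square power3_eq_cube mult.assoc moments)
  qed
  then show ?thesis
    using second_difference[OF assms] by (simp add: shift_const_def)
qed

section \<open>Vanishing of the mixed products of the forms lambda_i\<close>

lemma lam_in_polys [simp]: "i \<in> {1..m} \<Longrightarrow> lam m F i \<in> polys m"
  unfolding lam_def by (auto intro!: polys_add polys_sum)

lemma lam_last: "lam m F m = (\<Sum>j=1..m. Var j) + Const (shift_const m F)"
  by (simp add: lam_def)

lemma subst_lam_last:
  assumes "\<pi> permutes {1..m}"
  shows "subst_poly (lam m F m) (\<lambda>i. Var (\<pi> i)) = lam m F m"
proof -
  have "(\<Sum>j=1..m. Var (\<pi> j)) = (\<Sum>j=1..m. Var j)"
    using sum.permute[OF assms, of Var] by (simp add: o_def)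
  then show ?thesis by (simp add: lam_last)
qed

text \<open>Exchanging t_i and t_m fixes \<open>s\<close> and flips the sign of the other factor, so
  the value is its own negative.\<close>

lemma F_antisymmetric:
  assumes "i \<in> {1..m}" "s \<in> polys m"
    and "subst_poly s (\<lambda>k. Var (Transposition.transpose i m k)) = s"
  shows "F ((Var i - Var m) * s) = 0"
proof -
  have "F ((Var i - Var m) * s) = F ((Var m - Var i) * s)"
    using F_perm[of "Transposition.transpose i m" "(Var i - Var m) * s"] assms
    by (auto simp: permutes_swap_id)
  also have "\<dots> = F (- ((Var i - Var m) * s))"
    by (simp add: algebra_simps)
  also have "\<dots> = - F ((Var i - Var m) * s)"
    using assms by (intro F_uminus) auto
  finally show ?thesis by simp
qed

text \<open>Against the squared difference, t_a and t_b each contribute \<open>m111 - m112\<close>,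
  every other variable \<open>2 * (m112 - m123)\<close>, and the constant is multiplied by
  \<open>2 * (m11 - m12)\<close>. The total without the constant is twice the numerator in
  \<open>shift_const_eq\<close>, so that constant cancels it.\<close>

lemma F_square_difference_lam_last:
  assumes a: "a \<in> {1..m}" and b: "b \<in> {1..m}" and ab: "a \<noteq> b" and D: "m11 \<noteq> m12"
  shows "F ((Var a - Var b) * (Var a - Var b) * lam m F m) = 0"
proof -
  let ?q = "(Var a - Var b) * (Var a - Var b)"
  have m: "2 \<le> m" using a b ab by auto
  have q: "?q \<in> polys m" using a b by simp
  have qV: "?q * Var j \<in> polys m" if "j \<in> {1..m}" for j
    using polys_mult[OF q polys_Var[OF that]] .
  have sum: "(\<Sum>j=1..m. ?q * Var j) \<in> polys m"
    by (intro polys_sum qV)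
  have "?q * lam m F m = (\<Sum>j=1..m. ?q * Var j) + Const (shift_const m F) * ?q"
    by (simp only: lam_last distrib_left sum_distrib_left mult.commute[of ?q "Const _"])
  then have "F (?q * lam m F m) = (\<Sum>j=1..m. F (?q * Var j)) + shift_const m F * F ?q"
    using F_add[OF sum polys_mult[OF polys_Const q]] F_sum[of "{1..m}" "\<lambda>j. ?q * Var j"] qV q by simp
  also have "F ?q = 2 * (m11 - m12)"
    using a b ab by (simp add: ring_distribs mult.assoc moments)
  also have "(\<Sum>j=1..m. F (?q * Var j)) =
      F (?q * Var a) + F (?q * Var b) + (\<Sum>j\<in>{1..m} - {a, b}. F (?q * Var j))"
  proof -
    have "{1..m} = insert a (insert b ({1..m} - {a, b}))" using a b by auto
    then have "(\<Sum>j=1..m. F (?q * Var j)) = (\<Sum>j\<in>insert a (insert b ({1..m} - {a, b})). F (?q * Var j))"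
      by simp
    also have "\<dots> = F (?q * Var a) + F (?q * Var b) + (\<Sum>j\<in>{1..m} - {a, b}. F (?q * Var j))"
      using ab by (simp add: add.assoc)
    finally show ?thesis .
  qed
  also have "F (?q * Var a) = m111 - m112"
    using a b ab by (simp add: ring_distribs mult.assoc moments)
  also have "F (?q * Var b) = m111 - m112"
    using a b ab by (simp add: ring_distribs mult.assoc moments)
  also have "(\<Sum>j\<in>{1..m} - {a, b}. F (?q * Var j)) = (\<Sum>j\<in>{1..m} - {a, b}. 2 * (m112 - m123))"
    using a b ab by (intro sum.cong refl) (simp add: ring_distribs mult.assoc moments)
  also have "\<dots> = (real m - 2) * (2 * (m112 - m123))"
    using a b ab m by (simp add: card_Diff_subset of_nat_diff)
  finally show ?thesis
    using D m by (simp add: shift_const_eq field_simps)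
qed

lemma F_lam_products_vanish:
  assumes i: "i \<in> {1..<m}" and j: "j \<in> {1..m}" and D: "m11 \<noteq> m12"
  shows "F (lam m F i * lam m F m) = 0" "F (lam m F i * lam m F j * lam m F m) = 0"
proof -
  let ?l = "lam m F m"
  have l: "?l \<in> polys m"
    using i by simp
  have lam: "lam m F k = Var k - Var m" if "k \<in> {1..<m}" for k
    using that by (simp add: lam_def)
  have \<pi>: "Transposition.transpose i m permutes {1..m}"
    using i by (intro permutes_swap_id) auto
  show "F (lam m F i * ?l) = 0"
    using i l F_antisymmetric[of i ?l] subst_lam_last[OF \<pi>] by (simp add: lam)
  show "F (lam m F i * lam m F j * lam m F m) = 0"
  proof (cases "j = m")
    case True
    then show ?thesis
      using i l F_antisymmetric[of i "?l * ?l"] subst_lam_last[OF \<pi>] by (simp add: lam mult.assoc)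
  next
    case False
    then have j': "j \<in> {1..<m}" using j by auto
    have square: "F ((Var a - Var b) * (Var a - Var b) * ?l) = 0"
      if "a \<in> {1..m}" "b \<in> {1..m}" for a b
      using F_square_difference_lam_last[OF that] D by (cases "a = b") auto
    \<comment> \<open>Polarization in the form uv + uv = u^2 + v^2 - (u - v)^2, where u = t_i - t_m,
      v = t_j - t_m and u - v = t_i - t_j. As \<open>square\<close> admits equal indices,
      \<open>i = j\<close> needs no separate treatment.\<close>
    have "F ((Var i - Var m) * (Var j - Var m) * ?l) + F ((Var i - Var m) * (Var j - Var m) * ?l) =
        F ((Var i - Var m) * (Var j - Var m) * ?l + (Var i - Var m) * (Var j - Var m) * ?l)"
      using i j l by (intro F_add[symmetric]) auto
    also have "(Var i - Var m) * (Var j - Var m) * ?l + (Var i - Var m) * (Var j - Var m) * ?l =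
        (Var i - Var m) * (Var i - Var m) * ?l + (Var j - Var m) * (Var j - Var m) * ?l
          - (Var i - Var j) * (Var i - Var j) * ?l"
      by (simp add: algebra_simps)
    also have "F \<dots> = 0"
      using i j l square by simp
    finally show ?thesis
      using i j' by (simp add: lam)
  qed
qed

end

section \<open>The reduced functional and its moments\<close>

context symmetric_functional
begin

abbreviation "reduced \<xi> \<equiv> moment_functional \<xi> F (lam m F)"

lemma reduced_eq_subst:
  "p \<in> polys (m - 1) \<Longrightarrow>
    reduced \<xi> p = F (subst_poly p (lam m F)) + eval_poly p (\<lambda>_. 0) * (\<xi> - F 1)"
  by (subst moment_functional_eq_subst[of p "m - 1"]) (auto simp: eval_poly_at_zero)

text \<open>A permutation of \<open>{1..m - 1}\<close> fixes \<open>m\<close>, so it permutes the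
  differences t_i - t_m, and symmetry of \<open>F\<close> under it as a permutation of
  \<open>{1..m}\<close> applies. The correction at the constant term is unaffected.\<close>

lemma symmetric_functional_reduced: "symmetric_functional (m - 1) (reduced \<xi>)"
proof unfold_locales
  show "linear_functional (m - 1) (reduced \<xi>)"
    by (rule linear_functional_moment_functional)
  show "perm_symmetrical (m - 1) (reduced \<xi>)"
    unfolding perm_symmetrical_def
  proof (intro allI impI ballI)
    fix \<pi> and p
    assume \<pi>: "\<pi> permutes {1..m - 1}" and p: "p \<in> polys (m - 1)"
    let ?v = "\<lambda>i. Var (\<pi> i)"
    have in_range: "\<pi> i \<in> {1..m - 1}" if "i \<in> {1..m - 1}" for i
      using \<pi> that permutes_in_image by metis
    then have sp: "subst_poly p ?v \<in> polys (m - 1)"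
      using p by (intro subst_poly_in_polys) (auto simp del: atLeastAtMost_iff)
    have "\<pi> m = m" if "m \<noteq> 0"
      using \<pi> that by (intro permutes_not_in) auto
    then have "lam m F (\<pi> i) = subst_poly (lam m F i) ?v" if "i \<in> {1..m - 1}" for i
      using that in_range[OF that] by (auto simp: lam_def)
    then have "subst_poly p (\<lambda>i. lam m F (\<pi> i)) = subst_poly (subst_poly p (lam m F)) ?v"
      unfolding subst_poly_subst_poly using p by (intro subst_poly.ev_cong)
    moreover have "F \<dots> = F (subst_poly p (lam m F))"
      using permutes_subset[OF \<pi>, of "{1..m}"] p
      by (intro F_perm subst_poly_in_polys[of _ "m - 1"]) auto
    ultimately show "reduced \<xi> (subst_poly p ?v) = reduced \<xi> p"
      using p sp by (simp add: reduced_eq_subst subst_poly_subst_poly eval_poly_subst_poly)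
  qed
qed

text \<open>The substituted arguments are (t_1 - t_m)(t_1 - t_2), (t_1 - t_m)^2 (t_1 - t_2) and (t_1
  - t_m)(t_2 - t_m)(t_1 - t_3). The bounds on \<open>m\<close> make the indices distinct; in the
  third expansion all moments cancel.\<close>

lemma reduced_differences:
  shows "3 \<le> m \<Longrightarrow> reduced \<xi> ((Var 1)\<^sup>2 - Var 1 * Var 2) = F ((Var 1)\<^sup>2 - Var 1 * Var 2)"
    and "3 \<le> m \<Longrightarrow> reduced \<xi> (Var 1 * (Var 1 * Var 1) - Var 1 * (Var 1 * Var 2)) =
      m111 - 3 * m112 + 2 * m123"
    and "4 \<le> m \<Longrightarrow> reduced \<xi> (Var 1 * (Var 1 * Var 2) - Var 1 * (Var 2 * Var 3)) = 0"
  by (simp_all add: reduced_eq_subst lam_def power2_eq_square ring_distribs mult.assoc moments)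

text \<open>The first equation keeps the denominator of the constants nonzero down the recursion;
  the other two control the numerator.\<close>

lemma reduced_moments:
  assumes "3 \<le> m"
  shows "symmetric_functional.m11 (reduced \<xi>) - symmetric_functional.m12 (reduced \<xi>) = m11 - m12"
    and "symmetric_functional.m111 (reduced \<xi>) - symmetric_functional.m112 (reduced \<xi>) =
      m111 - 3 * m112 + 2 * m123"
    and "4 \<le> m \<Longrightarrow> symmetric_functional.m112 (reduced \<xi>) = symmetric_functional.m123 (reduced \<xi>)"
proof -
  interpret R: symmetric_functional "m - 1" "reduced \<xi>"
    by (rule symmetric_functional_reduced)
  show "R.m11 - R.m12 = m11 - m12"
    using assms reduced_differences(1)[of \<xi>] R.second_difference second_difference by simp
  show "R.m111 - R.m112 = m111 - 3 * m112 + 2 * m123"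
    using assms reduced_differences(2)[of \<xi>] unfolding R.m111_def R.m112_def by simp
  show "R.m112 = R.m123" if "4 \<le> m"
    using that reduced_differences(3)[of \<xi>] unfolding R.m123_def R.m112_def by simp
qed

section \<open>Change of basis, lifted nodes and the reduction step\<close>

definition hlam :: "nat \<Rightarrow> mpoly" where
  "hlam i = (if i = 0 then 1 else lam m F i)"

lemma hlam_in_polys [simp]: "i \<le> m \<Longrightarrow> hlam i \<in> polys m"
  by (simp add: hlam_def)

text \<open>Summing the differences gives m t_m = lambda_m - (lambda_1 + ... + lambda_(m-1)) - c,
  with c the shift constant, and then t_i = lambda_i + t_m. \<open>S\<close> is any set closed under
  linear combinations, so that \<open>cubature_step\<close> can take the factors for which its claim
  holds.\<close>

lemma hvar_in_span_hlam:
  assumes m: "m \<noteq> 0"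
    and add: "\<And>p q. p \<in> S \<Longrightarrow> q \<in> S \<Longrightarrow> p + q \<in> S"
    and scale: "\<And>a p. p \<in> S \<Longrightarrow> Const a * p \<in> S"
    and hlam: "\<And>i. i \<le> m \<Longrightarrow> hlam i \<in> S"
    and i: "i \<le> m"
  shows "hvar i \<in> S"
proof -
  have "0 \<in> S"
    using scale[OF hlam[of 0], of 0] by simp
  then have sum: "(\<Sum>i\<in>A. f i) \<in> S" if "\<And>i. i \<in> A \<Longrightarrow> f i \<in> S" for A and f :: "nat \<Rightarrow> mpoly"
    using that by (induction A rule: infinite_finite_induct) (simp_all add: add)
  have "(\<Sum>j=1..<m. hlam j) = (\<Sum>j=1..<m. Var j - Var m)"
    by (intro sum.cong) (auto simp: hlam_def lam_def)
  also have "\<dots> = (\<Sum>j=1..m. Var j) - of_nat m * Var m"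
  proof -
    have "{1..m} = insert m {1..<m}" using m by auto
    then have "(\<Sum>j=1..m. Var j) = Var m + (\<Sum>j=1..<m. Var j)" by simp
    moreover have "(of_nat m :: mpoly) = 1 + of_nat (m - 1)"
      using m by (metis Suc_pred' of_nat_Suc not_gr_zero)
    ultimately show ?thesis by (simp add: sum_subtractf distrib_right)
  qed
  finally have sum_hlam: "(\<Sum>j=1..<m. hlam j) = (\<Sum>j=1..m. Var j) - of_nat m * Var m" .
  have neg: "Const (- c) = - Const c" for c
    by (simp add: Const_def single_uminus)
  have "Const (1 / real m) * of_nat m = 1"
    using m by (simp add: Const_def mult_single flip: single_of_nat)
  then have "Var m = Const (1 / real m) * (of_nat m * Var m)"
    by (simp flip: mult.assoc)
  also have "of_nat m * Var m =
      hlam m + Const (- 1) * (\<Sum>j=1..<m. hlam j) + Const (- shift_const m F) * hlam 0"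
    unfolding sum_hlam using m by (simp add: hlam_def lam_last neg)
  finally have last: "Var m \<in> S"
    by (metis (no_types, lifting) add scale sum hlam atLeastLessThan_iff le0 less_imp_le order_refl)
  show ?thesis
  proof (cases "i = 0 \<or> i = m")
    case True
    then show ?thesis
      using last hlam[of 0] m by (auto simp: hlam_def hvar_def)
  next
    case False
    then have "hvar i = hlam i + Var m"
      using i by (simp add: hlam_def lam_def)
    then show ?thesis
      using add hlam[OF i] last by simp
  qed
qed

text \<open>The point with lambda_i = \<open>q i\<close> for \<open>i < m\<close> and lambda_m = 0:
  the differences fix it up to a common shift, and the shift is chosen to make the coordinates sum
  to \<open>- shift_const m F\<close>.\<close>

definition lift_node :: "(nat \<Rightarrow> real) \<Rightarrow> nat \<Rightarrow> real" where
  "lift_node q j = (if j < m then q j else 0) - ((\<Sum>i=1..<m. q i) + shift_const m F) / real m"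

definition diagonal_node :: "real \<Rightarrow> nat \<Rightarrow> real" where
  "diagonal_node \<tau> = (\<lambda>_. (\<tau> - shift_const m F) / real m)"

lemma eval_hlam:
  assumes "m \<noteq> 0" "i \<le> m"
  shows "eval_poly (hlam i) (lift_node q) = (if i = m then 0 else eval_poly (hvar i) q)"
    and "eval_poly (hlam i) (diagonal_node \<tau>) = (if i = 0 then 1 else if i = m then \<tau> else 0)"
proof -
  have "{1..m} = insert m {1..<m}" using assms by auto
  then have "(\<Sum>j=1..m. lift_node q j) = lift_node q m + (\<Sum>j=1..<m. lift_node q j)" by simp
  also have "(\<Sum>j=1..<m. lift_node q j) =
      (\<Sum>j=1..<m. q j - ((\<Sum>i=1..<m. q i) + shift_const m F) / real m)"
    by (intro sum.cong) (auto simp: lift_node_def)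
  also have "\<dots> = (\<Sum>j=1..<m. q j) - (real m - 1) * (((\<Sum>i=1..<m. q i) + shift_const m F) / real m)"
    using assms by (simp add: sum_subtractf of_nat_diff)
  finally have "(\<Sum>j=1..m. lift_node q j) = - shift_const m F"
    using assms by (simp add: lift_node_def field_simps)
  then show "eval_poly (hlam i) (lift_node q) = (if i = m then 0 else eval_poly (hvar i) q)"
    using assms by (auto simp: hlam_def lam_def lift_node_def)
  show "eval_poly (hlam i) (diagonal_node \<tau>) = (if i = 0 then 1 else if i = m then \<tau> else 0)"
    using assms by (auto simp: hlam_def lam_def diagonal_node_def)
qed

lemma F_hlam_products_vanish:
  assumes "i \<in> {1..<m}" "j \<le> m" "m11 \<noteq> m12"
  shows "F (hlam i * hlam j * hlam m) = 0"
proof (cases "j = 0")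
  case True
  then show ?thesis
    using assms F_lam_products_vanish(1)[of i m] by (simp add: hlam_def)
next
  case False
  then show ?thesis
    using assms F_lam_products_vanish(2)[of i j] by (simp add: hlam_def)
qed

text \<open>Both sides are linear, so triple products of \<open>hlam\<close> suffice. With a factor
  \<open>hlam m\<close> the lifted points contribute 0: a further difference makes both sides
  vanish, and otherwise the quadrature formula applies. Without it the diagonal points contribute
  only at 1, where \<open>\<xi>1 + \<xi>2 = F 1\<close> splits the mass.\<close>

lemma cubature_step:
  assumes m: "2 \<le> m" and D: "m11 \<noteq> m12" and \<xi>: "\<xi>1 + \<xi>2 = F 1"
    and reduced: "\<And>f. f \<in> polys3 (m - 1) \<Longrightarrow> reduced \<xi>1 f = (\<Sum>s\<in>I. u s * eval_poly f (q s))"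
    and quad: "quadrature3 (moment_functional \<xi>2 F (\<lambda>_. lam m F m)) M t w"
    and f: "f \<in> polys3 m"
  shows "F f = (\<Sum>s\<in>I. u s * eval_poly f (lift_node (q s))) +
    (\<Sum>i=1..M. w i * eval_poly f (diagonal_node (t i)))"
proof -
  define R where "R f = (\<Sum>s\<in>I. u s * eval_poly f (lift_node (q s))) +
    (\<Sum>i=1..M. w i * eval_poly f (diagonal_node (t i)))" for f
  \<comment> \<open>Membership in \<open>polys m\<close> is carried along because \<open>F\<close>
    is linear only there.\<close>
  define P where "P f \<longleftrightarrow> f \<in> polys m \<and> F f = R f" for f
  have R_add: "R (p + p') = R p + R p'" for p p'
    by (simp add: R_def distrib_left sum.distrib)
  have R_scale: "R (Const a * p) = a * R p" for a p
    by (simp add: R_def distrib_left sum_distrib_left mult_ac)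
  have add: "P (p + p')" if "P p" "P p'" for p p'
    using that by (simp add: P_def R_add)
  have scale: "P (Const a * p)" if "P p" for a p
    using that by (simp add: P_def R_scale)
  let ?G = "moment_functional \<xi>2 F (\<lambda>_. lam m F m)"
  have last: "P (hlam i * hlam j * hlam m)" if ij: "i \<le> m" "j \<le> m" for i j
  proof -
    have R: "R (hlam i * hlam j * hlam m) =
        (\<Sum>k=1..M. w k * (eval_poly (hlam i) (diagonal_node (t k)) * eval_poly (hlam j) (diagonal_node (t k)) * t k))"
      using m ij by (simp add: R_def eval_hlam(1)[of m] eval_hlam(2)[of m])
    consider "i \<in> {1..<m}" | "j \<in> {1..<m}" | "i \<in> {0, m}" "j \<in> {0, m}"
      using ij by fastforce
    then have "F (hlam i * hlam j * hlam m) = R (hlam i * hlam j * hlam m)"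
    proof cases
      case 1
      then show ?thesis
        unfolding R using ij D m by (simp add: F_hlam_products_vanish eval_hlam(2)[of i])
    next
      case 2
      then show ?thesis
        unfolding R using ij D m F_hlam_products_vanish[of j i]
        by (simp add: eval_hlam(2)[of j] mult.commute[of "hlam i"])
    next
      case 3
      \<comment> \<open>Translates the indices 0 and \<open>m\<close> into the indices 0 and 1 of a
        univariate product. As \<open>e m = 1\<close>, the product is not 1, and \<open>?G\<close>
        takes its value from \<open>F\<close> instead of \<open>\<xi>2\<close>.\<close>
      define e :: "nat \<Rightarrow> nat" where "e k = of_bool (k = m)" for k
      have e: "hlam k = (if e k = 0 then 1 else lam m F m)"
          "eval_poly (hlam k) (diagonal_node \<tau>) = eval_poly (hvar (e k)) (\<lambda>_. \<tau>)" if "k \<in> {0, m}" for k \<tau>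
        using that m eval_hlam(2)[of k \<tau>] by (auto simp: e_def hlam_def)
      have "e m = 1" by (simp add: e_def)
      have "F (hlam i * hlam j * hlam m) = ?G (hvar (e i) * hvar (e j) * hvar (e m))"
        unfolding moment_functional_hvar using 3 \<open>e m = 1\<close> by (simp add: e(1))
      also have "\<dots> = (\<Sum>k=1..M. w k * eval_poly (hvar (e i) * hvar (e j) * hvar (e m)) (\<lambda>_. t k))"
        using quad hvar_product_in_polys3[of "e i" 1 "e j" "e m"]
        unfolding quadrature3_def by (simp add: e_def)
      also have "\<dots> = R (hlam i * hlam j * hlam m)"
        unfolding R using 3 \<open>e m = 1\<close> by (simp add: e(2))
      finally show ?thesis .
    qed
    then show ?thesis
      using ij by (simp add: P_def)
  qed
  have hlam: "P (hlam i * hlam j * hlam l)" if ijl: "i \<le> m" "j \<le> m" "l \<le> m" for i j l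
  proof (cases "i = m \<or> j = m \<or> l = m")
    case True
    then show ?thesis
      using last[OF ijl(1,2)] last[OF ijl(1,3)] last[OF ijl(2,3)] by (auto simp: mult_ac)
  next
    case False
    let ?p = "hvar i * hvar j * hvar l"
    have lt: "i < m" "j < m" "l < m" using False ijl by auto
    have red: "reduced \<xi>1 ?p = (\<Sum>s\<in>I. u s * eval_poly ?p (q s))"
      using lt by (intro reduced hvar_product_in_polys3) auto
    have R: "R (hlam i * hlam j * hlam l) = reduced \<xi>1 ?p +
        (if i = 0 \<and> j = 0 \<and> l = 0 then \<Sum>k=1..M. w k else 0)"
      unfolding red R_def using m lt by (auto simp: eval_hlam)
    have "F (hlam i * hlam j * hlam l) = R (hlam i * hlam j * hlam l)"
    proof (cases "i = 0 \<and> j = 0 \<and> l = 0")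
      case True
      have "?G 1 = (\<Sum>k=1..M. w k)"
        using quad hvar_product_in_polys3[of 0 1 0 0] unfolding quadrature3_def by fastforce
      then show ?thesis
        using True \<xi> unfolding R by (simp add: moment_functional_moments hlam_def)
    next
      case False
      then show ?thesis
        unfolding R moment_functional_hvar by (auto simp: hlam_def)
    qed
    then show ?thesis
      using ijl by (simp add: P_def)
  qed
  have m0: "m \<noteq> 0" using m by simp
  \<comment> \<open>The forms \<open>hlam\<close> are exchanged for variables one factor at a
    time.\<close>
  have 1: "P (hvar i * hlam j * hlam l)" if "i \<le> m" "j \<le> m" "l \<le> m" for i j l
    using hvar_in_span_hlam[OF m0, of "{p. P (p * hlam j * hlam l)}" i] that hlam
    by (auto simp: distrib_right mult.assoc intro: add scale)
  have 2: "P (hvar i * hvar j * hlam l)" if "i \<le> m" "j \<le> m" "l \<le> m" for i j l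
    using hvar_in_span_hlam[OF m0, of "{p. P (hvar i * p * hlam l)}" j] that 1
    by (auto simp: distrib_left distrib_right mult.assoc mult.left_commute[of _ "Const _"] intro: add scale)
  have 3: "P (hvar i * hvar j * hvar l)" if "i \<le> m" "j \<le> m" "l \<le> m" for i j l
    using hvar_in_span_hlam[OF m0, of "{p. P (hvar i * hvar j * p)}" l] that 2
    by (auto simp: distrib_left mult.left_commute[of _ "Const _"] intro: add scale)
  have "P f"
    using f by (induction rule: polys3_induct) (auto intro: add scale 3)
  then show ?thesis by (simp add: P_def R_def)
qed

end

section \<open>The decomposition\<close>

locale decomposition =
  fixes n :: nat and L :: "mpoly \<Rightarrow> real" and \<xi>1 \<xi>2 :: "nat \<Rightarrow> real"
  assumes n: "2 \<le> n"
    and L_linear: "linear_functional n L"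
    and L_positive: "square_positive n L"
    and L_symmetrical: "perm_symmetrical n L"
begin

abbreviation "LF \<equiv> lower_functional n L \<xi>1"
abbreviation "c \<equiv> c_const n L \<xi>1"

lemma symmetric_functional_LF: "symmetric_functional (n - k) (LF k)"
proof (induction k)
  case 0
  show ?case
    using L_linear L_symmetrical by unfold_locales simp_all
next
  case (Suc k)
  then interpret symmetric_functional "n - k" "LF k" .
  show ?case
    using symmetric_functional_reduced[of "\<xi>1 k"] by (simp add: Let_def)
qed

text \<open>Square positivity enters through L((t_1 - t_2)^2) = 2 (m11 - m12) > 0; each reduction
  preserves the difference.\<close>

lemma second_difference_nonzero:
  assumes "k \<le> n - 2"
  shows "symmetric_functional.m11 (LF k) \<noteq> symmetric_functional.m12 (LF k)"
  using assms
proof (induction k)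
  case 0
  interpret symmetric_functional n L
    using L_linear L_symmetrical by unfold_locales
  have "eval_poly (Var 1 - Var 2) (\<lambda>i. of_bool (i = 1)) = 1"
    by simp
  then have "Var 1 - Var 2 \<noteq> 0"
    by (metis eval_poly.ev_zero zero_neq_one)
  then have "L ((Var 1 - Var 2)\<^sup>2) > 0"
    using L_positive n by (simp add: square_positive_def)
  moreover have "L ((Var 1 - Var 2)\<^sup>2) = 2 * (m11 - m12)"
    using n by (simp add: power2_eq_square ring_distribs moments)
  ultimately show ?case by simp
next
  case (Suc k)
  interpret symmetric_functional "n - k" "LF k"
    by (rule symmetric_functional_LF)
  show ?case
    using Suc reduced_moments(1)[of "\<xi>1 k"] by (force simp: Let_def)
qed

section \<open>The constants c_j\<close>

lemma mixed_third_moments_equal: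
  assumes "0 < k" "k \<le> n - 3"
  shows "symmetric_functional.m112 (LF k) = symmetric_functional.m123 (LF k)"
proof -
  obtain k' where k: "k = Suc k'"
    using assms gr0_implies_Suc by blast
  interpret symmetric_functional "n - k'" "LF k'"
    by (rule symmetric_functional_LF)
  show ?thesis
    using assms reduced_moments(3)[of "\<xi>1 k'"] unfolding k by (simp add: Let_def)
qed

lemma c_eq_shift_const: "k \<le> n \<Longrightarrow> c (n - k) = shift_const (n - k) (LF k)"
  by (simp add: c_const_def)

text \<open>Once the mixed moments agree, the numerator of the constant collapses to
  \<open>m111 - m112\<close>, which the reduction preserves, like the denominator.\<close>

lemma c_Suc:
  assumes "0 < k" "k \<le> n - 3"
  shows "c (n - Suc k) = c (n - k)"
proof -
  interpret F: symmetric_functional "n - k" "LF k"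
    by (rule symmetric_functional_LF)
  interpret R: symmetric_functional "n - Suc k" "LF (Suc k)"
    by (rule symmetric_functional_LF)
  have LF: "LF (Suc k) = F.reduced (\<xi>1 k)"
    by (simp add: Let_def)
  have "3 \<le> n - k" using assms by auto
  then have "R.m11 - R.m12 = F.m11 - F.m12" "R.m111 - R.m112 = F.m111 - F.m112"
    using F.reduced_moments(1,2)[of "\<xi>1 k"] mixed_third_moments_equal[OF assms]
    unfolding LF by simp_all
  \<comment> \<open>With two variables left the mixed moments may differ, but then
    \<open>m123\<close> has coefficient 0 and \<open>m112\<close> has coefficient -1.\<close>
  moreover have "R.m112 = R.m123 \<or> n - Suc k = 2"
    using assms mixed_third_moments_equal[of "Suc k"] by linarith
  then have "R.m111 + (real (n - Suc k) - 3) * R.m112 - (real (n - Suc k) - 2) * R.m123 = R.m111 - R.m112"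
    by (auto simp: algebra_simps)
  moreover have "F.m111 + (real (n - k) - 3) * F.m112 - (real (n - k) - 2) * F.m123 = F.m111 - F.m112"
    using mixed_third_moments_equal[OF assms] by (simp add: algebra_simps)
  ultimately show ?thesis
    using assms by (simp add: c_eq_shift_const R.shift_const_eq F.shift_const_eq del: lower_functional.simps)
qed

text \<open>Only the first reduction changes the constant: from \<open>\<L>\<^sub>1\<close> on the
  moments of \<open>t\<^sub>1\<^sup>2t\<^sub>2\<close> and \<open>t\<^sub>1t\<^sub>2t\<^sub>3\<close> agree. This is why a single
  number \<open>\<gamma>\<close> fills all the trailing coordinates of the nodes.\<close>

lemma c_constant:
  assumes "2 \<le> j" "j < n"
  shows "c j = c 2"
  using assms
proof (induction j rule: dec_induct)
  case (step j)
  then show ?case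
    using c_Suc[of "n - Suc j"] by simp
qed simp

section \<open>Nodes of the intermediate formulas\<close>

abbreviation "\<gamma> \<equiv> gamma n c"

text \<open>Offsets from \<open>\<gamma>\<close> vanish past position \<open>n - k + 2\<close>, so
  \<open>N\<close> does not matter. For \<open>k < n\<close>, \<open>n - k + 2\<close> copies of the
  beta offset give \<open>- \<tau>\<close>, and the excess of alpha over beta adds
  \<open>\<tau> - c 2\<close>.\<close>

lemma node_offset_sum:
  assumes "3 \<le> k" "k \<le> n" "n - k + 2 \<le> N"
  shows "(\<Sum>j=1..N. node n c k \<tau> j - \<gamma>) = - c 2"
proof -
  let ?p = "n - k + 1"
  have eq: "{1..N} = insert (Suc ?p) {1..?p} \<union> {Suc (Suc ?p)..N}"
    using assms by auto
  have "(\<Sum>j=1..N. node n c k \<tau> j - \<gamma>) =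
      (\<Sum>j\<in>insert (Suc ?p) {1..?p}. node n c k \<tau> j - \<gamma>) + (\<Sum>j=Suc (Suc ?p)..N. node n c k \<tau> j - \<gamma>)"
    unfolding eq by (intro sum.union_disjoint) auto
  also have "(\<Sum>j=Suc (Suc ?p)..N. node n c k \<tau> j - \<gamma>) = 0"
    by (intro sum.neutral) (auto simp: node_def)
  also have "(\<Sum>j\<in>insert (Suc ?p) {1..?p}. node n c k \<tau> j - \<gamma>) =
      (node n c k \<tau> (Suc ?p) - \<gamma>) + (\<Sum>j=1..?p. node n c k \<tau> j - \<gamma>)"
    by simp
  also have "(\<Sum>j=1..?p. node n c k \<tau> j - \<gamma>) = (\<Sum>j=1..?p. alpha n c k \<tau> - \<gamma>)"
    by (intro sum.cong) (auto simp: node_def)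
  also have "\<dots> = (real (n - k) + 1) * (alpha n c k \<tau> - \<gamma>)"
    by simp
  also have "node n c k \<tau> (Suc ?p) - \<gamma> = beta n c k \<tau> - \<gamma>"
    by (simp add: node_def)
  finally have sum: "(\<Sum>j=1..N. node n c k \<tau> j - \<gamma>) =
      (beta n c k \<tau> - \<gamma>) + (real (n - k) + 1) * (alpha n c k \<tau> - \<gamma>)" by simp
  show ?thesis
  proof (cases "k = n")
    case True
    then show ?thesis
      unfolding sum using assms by (simp add: alpha_def beta_def field_simps)
  next
    case False
    define x where "x = real (n - k)"
    have "c (Suc (n - k)) = c 2"
      using assms False by (intro c_constant) auto
    then have diff: "alpha n c k \<tau> - \<gamma> = (beta n c k \<tau> - \<gamma>) + (\<tau> - c 2) / (x + 1)"
        and beta: "beta n c k \<tau> - \<gamma> = - \<tau> / (x + 2)"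
      using assms False by (simp_all add: alpha_def beta_def x_def add.commute)
    have "x + 1 \<noteq> 0" "x + 2 \<noteq> 0"
      by (simp_all add: x_def)
    then have "(x + 1) * (alpha n c k \<tau> - \<gamma>) = (x + 1) * (beta n c k \<tau> - \<gamma>) + (\<tau> - c 2)"
        and "(x + 2) * (beta n c k \<tau> - \<gamma>) = - \<tau>"
      unfolding diff distrib_left by (simp_all add: beta)
    then show ?thesis
      unfolding sum x_def[symmetric] by (simp add: algebra_simps)
  qed
qed

text \<open>For the formula of \<open>\<L>\<^sub>k\<close>, the trailing coordinates of the points are \<open>\<gamma>\<close> for \<open>k = 0\<close> and to 0 for \<open>k > 0\<close>.\<close>

definition level_node :: "nat \<Rightarrow> nat \<Rightarrow> real \<Rightarrow> nat \<Rightarrow> real" where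
  "level_node k k' \<tau> =
     (if k' = Suc k then (\<lambda>_. if k' = n then \<tau> else (\<tau> - c (n - k)) / real (n - k))
      else (\<lambda>j. node n c k' \<tau> j - \<gamma> + (if k = 0 then \<gamma> else 0)))"

text \<open>For \<open>k' = k + 2\<close> the point of the next level is diagonal, or the raw node
  \<open>\<tau>\<close> if \<open>k' = n\<close>, since the last functional is univariate already;
  for larger \<open>k'\<close> it is a node offset by \<open>\<gamma>\<close>. In each case the
  shift made by \<open>lift_node\<close> has to be identified.\<close>

lemma lift_level_node:
  assumes k: "Suc k < n" and k': "Suc k < k'" "k' \<le> n" and j: "j \<in> {1..n - k}"
  shows "symmetric_functional.lift_node (n - k) (LF k) (level_node (Suc k) k' \<tau>) j = level_node k k' \<tau> j"
proof -
  interpret symmetric_functional "n - k" "LF k"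
    by (rule symmetric_functional_LF)
  let ?q = "level_node (Suc k) k' \<tau>"
  define m where "m = n - k"
  have m: "2 \<le> m" "n = m + k" using k by (auto simp: m_def)
  have shift: "shift_const m (LF k) = c m"
    using c_eq_shift_const[of k] k by (simp add: m_def)
  have lift: "lift_node ?q j = (if j < m then ?q j else 0) - ((\<Sum>i=1..<m. ?q i) + c m) / real m"
    using shift by (simp add: lift_node_def m_def)
  show ?thesis
  proof (cases "k' = Suc (Suc k)")
    case True
    show ?thesis
    proof (cases "k' = n")
      case n': True
      then have "m = 2" using True m by simp
      have q: "?q = (\<lambda>_. \<tau>)"
        unfolding level_node_def using True n' by simp
      have "lift_node ?q j = (if j < 2 then \<tau> else 0) - (\<tau> + c 2) / 2"
        unfolding lift unfolding q \<open>m = 2\<close> by simp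
      then show ?thesis
        using True n' j \<open>m = 2\<close> m(2) unfolding level_node_def
        by (auto simp: node_def beta_def alpha_def gamma_def)
    next
      case False
      then have m3: "3 \<le> m" using True k' m by auto
      have q: "?q = (\<lambda>_. (\<tau> - c (m - 1)) / (real m - 1))"
        unfolding level_node_def using True False m by (auto simp: of_nat_diff)
      have nk: "n - k' = m - 2" using True m by auto
      \<comment> \<open>The common shift, hence also the coordinate at position \<open>m\<close>,
        where \<open>node\<close> has its beta.\<close>
      define b where "b = - (\<tau> - c (m - 1) + c m) / real m"
      have "lift_node ?q j = (if j < m then (\<tau> - c (m - 1)) / (real m - 1) else 0) + b"
        unfolding lift unfolding q using m3 by (simp add: of_nat_diff b_def minus_divide_left[symmetric] del: minus_add_distrib minus_diff_eq)
      moreover have "beta n c k' \<tau> - \<gamma> + (if k = 0 then \<gamma> else 0) = b"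
      proof (cases "k = 0")
        case True
        then show ?thesis
          using False m m3 nk by (simp add: b_def beta_def gamma_def of_nat_diff field_simps)
      next
        case k0: False
        then have "c (m - 1) = c m"
          using c_constant[of m] c_constant[of "m - 1"] m(2) m3 by simp
        then show ?thesis
          using False m m3 nk k0 by (simp add: b_def beta_def of_nat_diff)
      qed
      moreover have "alpha n c k' \<tau> = beta n c k' \<tau> + (\<tau> - c (m - 1)) / (real m - 1)"
      proof -
        have "n - k' + 1 = m - 1" "k' \<noteq> 1" using nk m3 True by auto
        then show ?thesis
          using False m3 by (simp only: alpha_def if_False) (simp add: of_nat_diff)
      qed
      moreover have "node n c k' \<tau> j = (if j < m then alpha n c k' \<tau> else beta n c k' \<tau>)"
        using j m3 nk by (auto simp: node_def m_def)
      ultimately show ?thesis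
        unfolding level_node_def[of k] using True by auto
    qed
  next
    case False
    then have k3: "k' \<ge> Suc (Suc (Suc k))" using k' by auto
    have m3: "3 \<le> m" using k3 k' m by auto
    have q: "?q = (\<lambda>j. node n c k' \<tau> j - \<gamma>)"
      using k3 by (simp add: level_node_def)
    have "{1..<m} = {1..m - 1}" by auto
    \<comment> \<open>With this sum the shift becomes (c_(m-1) - c_m) / m, which is
      \<open>\<gamma>\<close> for \<open>k = 0\<close> and 0 afterwards, where the constants
      agree.\<close>
    then have "(\<Sum>i=1..<m. ?q i) = - c 2"
      unfolding q using node_offset_sum[of k' "m - 1" \<tau>] k3 k' m by simp
    also have "c 2 = c (m - 1)"
      using m m3 k3 k' by (intro c_constant[symmetric]) auto
    finally have "- ((\<Sum>i=1..<m. ?q i) + c m) / real m = (c (m - 1) - c m) / real m"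
      by simp
    also have "\<dots> = (if k = 0 then \<gamma> else 0)"
      using c_constant[of m] c_constant[of "m - 1"] m(2) m3 by (auto simp: gamma_def)
    finally have *: "- ((\<Sum>i=1..<m. ?q i) + c m) / real m = (if k = 0 then \<gamma> else 0)" .
    have "lift_node ?q j = (if j < m then ?q j else 0) + (if k = 0 then \<gamma> else 0)"
      unfolding lift *[symmetric] by (simp only: minus_divide_left[symmetric] add_uminus_conv_diff)
    moreover have "node n c k' \<tau> j = \<gamma>" if "\<not> j < m"
    proof -
      have "j > n - k' + 2" using that j k3 k' m(2) by auto
      then show ?thesis by (simp add: node_def)
    qed
    ultimately show ?thesis
      using k3 by (simp add: q level_node_def)
  qed
qed

text \<open>Induction downwards from \<open>k = n - 1\<close>, where \<open>LF k\<close> is the last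
  univariate functional. In each step the lifted points come from the level below and the diagonal
  points supply the summand \<open>k' = Suc k\<close>.\<close>

lemma lower_functional_cubature:
  assumes \<xi>: "\<And>k. k \<le> n - 2 \<Longrightarrow> \<xi>1 k + \<xi>2 k = LF k 1"
    and quad: "\<And>k. k \<in> {1..n} \<Longrightarrow> quadrature3 (upper_functional n L \<xi>1 \<xi>2 k) (M k) (t k) (w k)"
    and k: "k \<le> n - 1" and f: "f \<in> polys3 (n - k)"
  shows "LF k f = (\<Sum>k'=Suc k..n. \<Sum>i=1..M k'. w k' i * eval_poly f (level_node k k' (t k' i)))"
  using k f
proof (induction k arbitrary: f rule: inc_induct)
  case base
  have "upper_functional n L \<xi>1 \<xi>2 n f = (\<Sum>i=1..M n. w n i * eval_poly f (\<lambda>_. t n i))"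
    using quad[of n] base n unfolding quadrature3_def by auto
  then show ?case
    using n by (simp add: upper_functional_def level_node_def)
next
  case (step k)
  interpret symmetric_functional "n - k" "LF k"
    by (rule symmetric_functional_LF)
  have k: "Suc k < n" using step by auto
  \<comment> \<open>The double sum is indexed by pairs to match the single index set of
    \<open>cubature_step\<close>.\<close>
  let ?I = "SIGMA k':{Suc (Suc k)..n}. {1..M k'}"
  have red: "reduced (\<xi>1 k) g =
      (\<Sum>s\<in>?I. w (fst s) (snd s) * eval_poly g (level_node (Suc k) (fst s) (t (fst s) (snd s))))"
    if "g \<in> polys3 (n - k - 1)" for g
    using step.IH[of g] that by (simp add: sum.Sigma Let_def case_prod_unfold)
  have "quadrature3 (moment_functional (\<xi>2 k) (LF k) (\<lambda>_. lam (n - k) (LF k) (n - k)))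
      (M (Suc k)) (t (Suc k)) (w (Suc k))"
    using quad[of "Suc k"] k by (simp add: upper_functional_def Let_def)
  then have "LF k f = (\<Sum>s\<in>?I. w (fst s) (snd s) *
        eval_poly f (lift_node (level_node (Suc k) (fst s) (t (fst s) (snd s))))) +
      (\<Sum>i=1..M (Suc k). w (Suc k) i * eval_poly f (diagonal_node (t (Suc k) i)))"
    using k step.prems \<xi>[of k] second_difference_nonzero[of k] by (intro cubature_step[of "\<xi>1 k" "\<xi>2 k"] red) auto
  also have "(\<Sum>s\<in>?I. w (fst s) (snd s) *
        eval_poly f (lift_node (level_node (Suc k) (fst s) (t (fst s) (snd s))))) =
      (\<Sum>s\<in>?I. w (fst s) (snd s) * eval_poly f (level_node k (fst s) (t (fst s) (snd s))))"
  proof (intro sum.cong refl arg_cong2[of _ _ _ _ "(*)"])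
    \<comment> \<open>The two points are compared only in the first \<open>n - k\<close>
      coordinates, which are all that \<open>f\<close> sees.\<close>
    fix s assume s: "s \<in> ?I"
    show "eval_poly f (lift_node (level_node (Suc k) (fst s) (t (fst s) (snd s)))) =
        eval_poly f (level_node k (fst s) (t (fst s) (snd s)))"
      using step.prems s k
      by (intro eval_poly.ev_cong[of _ "n - k"] lift_level_node) (auto simp: polys3_def)
  qed
  also have "\<dots> = (\<Sum>k'=Suc (Suc k)..n. \<Sum>i=1..M k'. w k' i * eval_poly f (level_node k k' (t k' i)))"
    by (simp add: sum.Sigma case_prod_unfold)
  also have "diagonal_node = level_node k (Suc k)"
    using k c_eq_shift_const[of k] by (auto simp: diagonal_node_def level_node_def fun_eq_iff)
  finally show ?case
    using k by (simp add: sum.atLeast_Suc_atMost[of "Suc k" n] add.commute)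
qed

end

text \<open>The weights are the integrals of the Lagrange basis polynomials for the nodes 0, 1, 2, 3.\<close>

lemma ex_quadrature3:
  assumes "linear_functional 1 F"
  shows "\<exists>m t w. quadrature3 F m t w"
proof -
  interpret linear_functional_on 1 F
    using assms by unfold_locales
  let ?x = "Var 1"
  define w :: "nat \<Rightarrow> real" where "w i =
    (if i = 1 then F 1 - 11/6 * F ?x + F (?x * ?x) - 1/6 * F (?x * ?x * ?x)
     else if i = 2 then 3 * F ?x - 5/2 * F (?x * ?x) + 1/2 * F (?x * ?x * ?x)
     else if i = 3 then - 3/2 * F ?x + 2 * F (?x * ?x) - 1/2 * F (?x * ?x * ?x)
     else 1/3 * F ?x - 1/2 * F (?x * ?x) + 1/6 * F (?x * ?x * ?x))" for i
  \<comment> \<open>\<open>quadrature3\<close> counts its nodes from 1, so the nodes 0, 1, 2, 3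
    appear as \<open>real i - 1\<close>.\<close>
  have "g \<in> polys 1 \<and> F g = (\<Sum>i=1..4. w i * eval_poly g (\<lambda>_. real i - 1))" if "g \<in> polys3 1" for g
    using that
  proof (induction rule: polys3_induct)
    case (prod i j l)
    then have "i = 0 \<or> i = 1" "j = 0 \<or> j = 1" "l = 0 \<or> l = 1" by auto
    moreover have "{1..4::nat} = {1, 2, 3, 4}" by auto
    ultimately show ?case
      by (elim disjE) (simp_all add: w_def field_simps)
  qed (simp_all add: distrib_left sum.distrib sum_distrib_left mult.left_commute)
  then have "quadrature3 F 4 (\<lambda>i. real i - 1) w"
    by (simp add: quadrature3_def)
  then show ?thesis by blast
qed

theorem theorem3:
  fixes n :: nat and L :: "mpoly \<Rightarrow> real" and \<xi>1 \<xi>2 :: "nat \<Rightarrow> real"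
  assumes "n \<ge> 2"
    and "linear_functional n L" and "square_positive n L" and "perm_symmetrical n L"
    and "\<forall>k\<le>n - 2. \<xi>1 k + \<xi>2 k = lower_functional n L \<xi>1 k 1"
  shows "(\<forall>k\<in>{1..n}. \<exists>m t w. quadrature3 (upper_functional n L \<xi>1 \<xi>2 k) m t w) \<and>
    (\<forall>m t w. (\<forall>k\<in>{1..n}. quadrature3 (upper_functional n L \<xi>1 \<xi>2 k) (m k) (t k) (w k)) \<longrightarrow>
       (\<forall>f\<in>polys3 n. L f = cubature n (c_const n L \<xi>1) m t w f))"
proof (intro conjI ballI allI impI)
  interpret decomposition n L \<xi>1 \<xi>2
    using assms by unfold_locales
  {
    fix k assume "k \<in> {1..n}"
    show "\<exists>m t w. quadrature3 (upper_functional n L \<xi>1 \<xi>2 k) m t w"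
    proof (rule ex_quadrature3, cases "k = n")
      case True
      then show "linear_functional 1 (upper_functional n L \<xi>1 \<xi>2 k)"
        using symmetric_functional_LF[of "n - 1"] n
        by (simp add: upper_functional_def symmetric_functional_def linear_functional_on_def)
    next
      case False
      then show "linear_functional 1 (upper_functional n L \<xi>1 \<xi>2 k)"
        by (simp add: upper_functional_def Let_def linear_functional_moment_functional)
    qed
  next
    fix m t w f
    assume "\<forall>k\<in>{1..n}. quadrature3 (upper_functional n L \<xi>1 \<xi>2 k) (m k) (t k) (w k)" "f \<in> polys3 n"
    then have "L f = (\<Sum>k=1..n. \<Sum>i=1..m k. w k i * eval_poly f (level_node 0 k (t k i)))"
      using lower_functional_cubature[of m t w 0 f] assms(5) by simp
    also have "\<dots> = (\<Sum>k=2..n. \<Sum>i=1..m k. w k i * eval_poly f (level_node 0 k (t k i))) +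
        (\<Sum>i=1..m 1. w 1 i * eval_poly f (level_node 0 1 (t 1 i)))"
      using n by (subst sum.atLeast_Suc_atMost) (simp_all only: add.commute one_add_one plus_1_eq_Suc [symmetric])
    \<comment> \<open>At level 0 the offset \<open>\<gamma>\<close> is subtracted and added back, so
      \<open>level_node\<close> is \<open>node\<close> itself for \<open>k \<ge> 2\<close>.\<close>
    also have "\<dots> = cubature n (c_const n L \<xi>1) m t w f"
      using n by (simp add: cubature_def level_node_def alpha_def)
    finally show "L f = cubature n (c_const n L \<xi>1) m t w f" .
  }
qed

end
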